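(* Let $(G,\cdot,\wedge,\vdash)$ be an algebraic system, where $(G,\cdot)$ is a semigroup, $(G,\wedge)$ is a semilattice, and $\vdash$ is a binary relation on $G$. Let $\leq$ be the natural order of the semilattice, $x\leq y\Leftrightarrow x\wedge y=x$. Then $(G,\cdot,\wedge,\vdash)$ is isomorphic to a $\cap$-semigroup $(\Phi,\circ,\cap,\delta_\Phi)$ of transformations if and only if $\vdash$ is a left ideal relation on the semigroup $(G,\cdot)$, the conditions $$x(y\wedge z)=xy\wedge xz,\qquad (x\wedge y)z\leq yz$$ hold for all $x,y,z\in G$, and for every $n\in\mathbb N$ and all $x,y\in G$ the following two conditions hold: $$A_n:\quad \mathfrak M_n(x\wedge y,\{x\})\ \text{ implies }\ x\leq y;$$ $$B_n:\quad \mathfrak M_n(xy,\{x\})\ \text{ implies }\ x\vdash y.$$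
   Context: A transformation of a non-empty set $A$ is a partial map $A\to A$, regarded as a subset of $A\times A$; $\mathcal F(A)$ is the set of all of them. For $f\in\mathcal F(A)$, $\mathrm{pr}_1 f$ is the domain and $\mathrm{pr}_2 f$ the image of $f$. Composition is $(g\circ f)(a)=g(f(a))$, both sides being defined or undefined simultaneously. If $\Phi\subset\mathcal F(A)$ is closed under $\circ$ and under set-theoretic intersection $\cap$, then $(\Phi,\circ,\cap)$ is a $\cap$-semigroup of transformations. On $\Phi$ put $\delta_\Phi=\{(f,g)\mid \mathrm{pr}_2 f\subset\mathrm{pr}_1 g\}$ ($\subset$ is not necessarily strict). Isomorphism convention: $(G,\cdot,\wedge,\vdash)$ is isomorphic to $(\Phi,\circ,\cap,\delta_\Phi)$ (for some non-empty set $A$ and some $\Phi\subset\mathcal F(A)$ closed under $\circ$ and $\cap$) if there is a bijection $P:G\to\Phi$ such that for all $x,y\in G$: $P(xy)=P(y)\circ P(x)$, $P(x\wedge y)=P(x)\cap P(y)$, and $x\vdash y\Leftrightarrow (P(x),P(y))\in\delta_\Phi$. A semilattice is a set with an associative, commutative, idempotent operation. The relation $\vdash$ is left ideal if $x\vdash y$ implies $ux\vdash y$ for all $x,y,u\in G$. $\mathbb N$ is the set of non-negative integers. $G^*=G\cup\{e\}$, where $e\notin G$ is a new element with, by definition, $ee=e$, $e\leq e$, $e\vdash e$, $ex=xe=x$ and $x\vdash e$ for all $x\in G$. The formula $a\boxdot b\leq c$ abbreviates "$a\vdash b$ and $ab\leq c$". For $z\in G$, $H\subset G$ and $n\geq 1$,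 $\mathfrak M_n(z,H)$ is the statement: there exist $x_i,y_i,t_i\in G^*$ and $u_i,v_i,w_i\in G$ ($1\leq i\leq 2^n-1$) such that (i) $(u_1\wedge v_1\wedge w_1)x_1\boxdot y_1\leq zt_1$; (ii) for every $i$ with $1\leq i\leq 2^{n-1}-1$: $(u_{2i}\wedge v_{2i}\wedge w_{2i})x_{2i}\boxdot y_{2i}\leq (u_i\wedge v_i)t_{2i}$ and $(u_{2i+1}\wedge v_{2i+1}\wedge w_{2i+1})x_{2i+1}\boxdot y_{2i+1}\leq (v_i\wedge w_i)x_it_{2i+1}$; (iii) for every $i$ with $2^{n-1}\leq i\leq 2^n-1$: $u_i\wedge v_i\in H$ and $(v_i\wedge w_i)x_i\in H$. For $n=1$ condition (ii) is vacuous. For $n=0$, $\mathfrak M_0(z,H)$ is the statement $z\in H$. *)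

theory Defs
  imports Main
begin

section \<open>Semigroups of transformations closed under intersection\<close>

text \<open>Partial maps on a set are single-valued relations; \<^const>\<open>Domain\<close> and \<^const>\<open>Range\<close> are the
  projections \<open>pr\<^sub>1\<close> and \<open>pr\<^sub>2\<close>.\<close>

definition transformations :: "'b set \<Rightarrow> 'b rel set"
  where "transformations A = {f. f \<subseteq> A \<times> A \<and> single_valued f}"

text \<open>\<open>g\<close> after \<open>f\<close>; \<^const>\<open>relcomp\<close> takes its arguments in the opposite order.\<close>

definition after :: "'b rel \<Rightarrow> 'b rel \<Rightarrow> 'b rel"  (infixr \<open>\<circ>\<circ>\<close> 75)
  where "g \<circ>\<circ> f = f O g"

definition cap_semigroup :: "'b set \<Rightarrow> 'b rel set \<Rightarrow> bool"
  where "cap_semigroup A \<Phi> \<longleftrightarrow>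
    A \<noteq> {} \<and> \<Phi> \<subseteq> transformations A \<and>
    (\<forall>f\<in>\<Phi>. \<forall>g\<in>\<Phi>. g \<circ>\<circ> f \<in> \<Phi>) \<and> (\<forall>f\<in>\<Phi>. \<forall>g\<in>\<Phi>. f \<inter> g \<in> \<Phi>)"

definition delta :: "'b rel set \<Rightarrow> ('b rel \<times> 'b rel) set"
  where "delta \<Phi> = {(f, g). f \<in> \<Phi> \<and> g \<in> \<Phi> \<and> Range f \<subseteq> Domain g}"

text \<open>Note the reversal: a product \<open>x \<cdot> y\<close> is represented by first applying \<open>P x\<close>, then \<open>P y\<close>.\<close>

definition isomorphic_to ::
    "('g \<Rightarrow> 'g \<Rightarrow> 'g) \<Rightarrow> ('g \<Rightarrow> 'g \<Rightarrow> 'g) \<Rightarrow> ('g \<Rightarrow> 'g \<Rightarrow> bool) \<Rightarrow> 'b rel set \<Rightarrow> bool"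
  where "isomorphic_to mult meet vd \<Phi> \<longleftrightarrow>
    (\<exists>P. bij_betw P UNIV \<Phi> \<and>
      (\<forall>x y. P (mult x y) = P y \<circ>\<circ> P x) \<and>
      (\<forall>x y. P (meet x y) = P x \<inter> P y) \<and>
      (\<forall>x y. vd x y \<longleftrightarrow> (P x, P y) \<in> delta \<Phi>))"


section \<open>Semigroups with a semilattice operation and a relation\<close>

definition natural_le :: "('g \<Rightarrow> 'g \<Rightarrow> 'g) \<Rightarrow> 'g \<Rightarrow> 'g \<Rightarrow> bool"
  where "natural_le meet x y \<longleftrightarrow> meet x y = x"

definition left_ideal_rel :: "('g \<Rightarrow> 'g \<Rightarrow> 'g) \<Rightarrow> ('g \<Rightarrow> 'g \<Rightarrow> bool) \<Rightarrow> bool"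
  where "left_ideal_rel mult vd \<longleftrightarrow> (\<forall>x y u. vd x y \<longrightarrow> vd (mult u x) y)"

text \<open>\<open>G\<^sup>*\<close>, that is \<open>G\<close> with a new element \<open>e\<close>, is the type \<^typ>\<open>'g option\<close> with \<open>e\<close> encoded as
  \<^const>\<open>None\<close>. The order is extended by \<^const>\<open>rel_option\<close>, which adds only \<open>e \<le> e\<close>. The value of
  \<open>e \<turnstile> y\<close> for \<open>y \<in> G\<close> is set to false; the left-hand sides of \<open>\<turnstile>\<close> below are never \<open>e\<close>.\<close>

fun star_mult :: "('g \<Rightarrow> 'g \<Rightarrow> 'g) \<Rightarrow> 'g option \<Rightarrow> 'g option \<Rightarrow> 'g option"
  where
    "star_mult mult None b = b"
  | "star_mult mult (Some x) None = Some x"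
  | "star_mult mult (Some x) (Some y) = Some (mult x y)"

definition star_vd :: "('g \<Rightarrow> 'g \<Rightarrow> bool) \<Rightarrow> 'g option \<Rightarrow> 'g option \<Rightarrow> bool"
  where "star_vd vd a b \<longleftrightarrow>
    (case b of None \<Rightarrow> True | Some y \<Rightarrow> (case a of None \<Rightarrow> False | Some x \<Rightarrow> vd x y))"

text \<open>\<open>boxle mult meet vd a b c\<close> is the formula \<open>a \<boxdot> b \<le> c\<close>.\<close>

definition boxle ::
    "('g \<Rightarrow> 'g \<Rightarrow> 'g) \<Rightarrow> ('g \<Rightarrow> 'g \<Rightarrow> 'g) \<Rightarrow> ('g \<Rightarrow> 'g \<Rightarrow> bool) \<Rightarrow>
     'g option \<Rightarrow> 'g option \<Rightarrow> 'g option \<Rightarrow> bool"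
  where "boxle mult meet vd a b c \<longleftrightarrow>
    star_vd vd a b \<and> rel_option (natural_le meet) (star_mult mult a b) c"

text \<open>The families are indexed by all natural numbers, but only the indices from \<open>1\<close> to
  \<open>2 ^ n - 1\<close> are constrained.\<close>

definition \<MM> ::
    "('g \<Rightarrow> 'g \<Rightarrow> 'g) \<Rightarrow> ('g \<Rightarrow> 'g \<Rightarrow> 'g) \<Rightarrow> ('g \<Rightarrow> 'g \<Rightarrow> bool) \<Rightarrow> nat \<Rightarrow> 'g \<Rightarrow> 'g set \<Rightarrow> bool"
  where "\<MM> mult meet vd n z H \<longleftrightarrow>
    (if n = 0 then z \<in> H
     else
       (let mul = star_mult mult; box = boxle mult meet vd in
        \<exists>(x :: nat \<Rightarrow> 'g option) (y :: nat \<Rightarrow> 'g option) (t :: nat \<Rightarrow> 'g option)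
         (u :: nat \<Rightarrow> 'g) (v :: nat \<Rightarrow> 'g) (w :: nat \<Rightarrow> 'g).
          box (mul (Some (meet (meet (u 1) (v 1)) (w 1))) (x 1)) (y 1) (mul (Some z) (t 1)) \<and>
          (\<forall>i\<in>{1..2 ^ (n - 1) - 1}.
             box (mul (Some (meet (meet (u (2*i)) (v (2*i))) (w (2*i)))) (x (2*i)))
                 (y (2*i))
                 (mul (Some (meet (u i) (v i))) (t (2*i))) \<and>
             box (mul (Some (meet (meet (u (2*i+1)) (v (2*i+1))) (w (2*i+1)))) (x (2*i+1)))
                 (y (2*i+1))
                 (mul (mul (Some (meet (v i) (w i))) (x i)) (t (2*i+1)))) \<and>
          (\<forall>i\<in>{2 ^ (n - 1)..2 ^ n - 1}.
             meet (u i) (v i) \<in> H \<and>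
             mul (Some (meet (v i) (w i))) (x i) \<in> Some ` H)))"

end

(* Read z in H as "z is defined at a given point". One node of the tree in the condition M then says
   that z is defined there as soon as two further elements are, so M_n(z, H) means that z lies in the
   n-th iterate of a derivation operator on H. Necessity holds because the elements defined at a point
   are closed under derivation. For sufficiency, let H be the closure of {a}. The elements s of H,
   identified when their meet is in H, together with e form the states of a system of partial maps in
   which g sends s to sg whenever sg is in H. The disjoint union of these systems over all a
   represents G, and A_n and B_n, read at the state e of the system of a, make the union faithful for
   the order and for the relation. *)
theory Submission
  imports Defs
begin

section \<open>The trees as iterated derivations\<close>

definition derive_step ::
    "('g \<Rightarrow> 'g \<Rightarrow> 'g) \<Rightarrow> ('g \<Rightarrow> 'g \<Rightarrow> 'g) \<Rightarrow> ('g \<Rightarrow> 'g \<Rightarrow> bool) \<Rightarrow> 'g set \<Rightarrow> 'g set"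
  where "derive_step mult meet vd H =
    {z. \<exists>x y t u v w.
       boxle mult meet vd (star_mult mult (Some (meet (meet u v) w)) x) y
         (star_mult mult (Some z) t) \<and>
       meet u v \<in> H \<and> star_mult mult (Some (meet v w)) x \<in> Some ` H}"

lemma derive_step_mono: "mono (derive_step mult meet vd)"
  unfolding mono_def derive_step_def by blast

text \<open>The element labelling the node \<open>k\<close> of the binary tree whose root is \<open>1\<close>; it is determined by
  the data at the parent \<open>k div 2\<close>.\<close>

definition node_label ::
    "('g \<Rightarrow> 'g \<Rightarrow> 'g) \<Rightarrow> ('g \<Rightarrow> 'g \<Rightarrow> 'g) \<Rightarrow> 'g \<Rightarrow>
     (nat \<Rightarrow> 'g option) \<Rightarrow> (nat \<Rightarrow> 'g) \<Rightarrow> (nat \<Rightarrow> 'g) \<Rightarrow> (nat \<Rightarrow> 'g) \<Rightarrow> nat \<Rightarrow> 'g option"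
  where "node_label mult meet z x u v w k =
    (if k = 1 then Some z
     else if even k then Some (meet (u (k div 2)) (v (k div 2)))
     else star_mult mult (Some (meet (v (k div 2)) (w (k div 2)))) (x (k div 2)))"

lemma node_label_simps:
  "node_label mult meet z x u v w (Suc 0) = Some z"
  "node_label mult meet z x u v w (2 * k) = Some (meet (u k) (v k))"
  "0 < k \<Longrightarrow> node_label mult meet z x u v w (Suc (2 * k)) =
     star_mult mult (Some (meet (v k) (w k))) (x k)"
  by (simp_all add: node_label_def)

lemma all_double_interval:
  fixes a b :: nat
  shows "(\<forall>k\<in>{2 * a..<2 * b}. Q k) \<longleftrightarrow> (\<forall>i\<in>{a..<b}. Q (2 * i) \<and> Q (Suc (2 * i)))"
proof
  assume *: "\<forall>i\<in>{a..<b}. Q (2 * i) \<and> Q (Suc (2 * i))"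
  show "\<forall>k\<in>{2 * a..<2 * b}. Q k"
  proof
    fix k assume "k \<in> {2 * a..<2 * b}"
    then have "k div 2 \<in> {a..<b}" by auto
    with * have "Q (2 * (k div 2))" "Q (Suc (2 * (k div 2)))" by blast+
    then show "Q k" by (cases "even k") simp_all
  qed
qed auto

text \<open>With labels, the condition at the root has the same form as at the other nodes, and
  membership in \<open>H\<close> is asked of one extra level, the leaves. For \<open>n = 0\<close>
  the root is the only leaf.\<close>

lemma \<MM>_iff_node_label:
  "\<MM> mult meet vd n z H \<longleftrightarrow>
    (\<exists>x y t u v w.
      (\<forall>k\<in>{1..<2 ^ n}.
         boxle mult meet vd (star_mult mult (Some (meet (meet (u k) (v k)) (w k))) (x k)) (y k)
           (star_mult mult (node_label mult meet z x u v w k) (t k))) \<and>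
      (\<forall>k\<in>{2 ^ n..<2 ^ Suc n}. node_label mult meet z x u v w k \<in> Some ` H))"
proof (cases n)
  case 0
  have "{1..<2 ^ Suc 0} = {1::nat}" by auto
  then show ?thesis using 0 by (auto simp: \<MM>_def node_label_simps)
next
  case (Suc m)
  have "i \<le> 2 ^ k - 1 \<longleftrightarrow> i < 2 ^ k" for i k :: nat
    using zero_less_power[of "2::nat" k] by linarith
  then have interval: "{j..2 ^ k - 1} = {j..<2 ^ k}" for j k :: nat
    by (simp add: set_eq_iff)
  have "{1..<2 * j} = insert (Suc 0) {2 * 1..<2 * j}" if "1 \<le> j" for j
    using that by auto
  from this[of "2 ^ m"] have "{1..<2 ^ n} = insert (Suc 0) {2 * 1..<2 * 2 ^ m}"
    using Suc by simp
  then have nodes: "(\<forall>k\<in>{1..<2 ^ n}. Q k) \<longleftrightarrow>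
      Q (Suc 0) \<and> (\<forall>i\<in>{1..<2 ^ m}. Q (2 * i) \<and> Q (Suc (2 * i)))" for Q
    by (simp only: ball_simps all_double_interval)
  have "{2 ^ n..<2 ^ Suc n} = {2 * 2 ^ m..<2 * 2 ^ n :: nat}"
    using Suc by simp
  then have leaves: "(\<forall>k\<in>{2 ^ n..<2 ^ Suc n}. Q k) \<longleftrightarrow>
      (\<forall>i\<in>{2 ^ m..<2 ^ n}. Q (2 * i) \<and> Q (Suc (2 * i)))" for Q
    by (simp only: all_double_interval)
  \<comment> \<open>The rule for odd labels needs a positive parent: with parent 0 it would treat
    the root 1 as a child.\<close>
  have pos: "0 < i" if "2 ^ m \<le> i" for i :: nat
    using that zero_less_power[of "2::nat" m] by linarith
  have "n \<noteq> 0" "n - 1 = m" using Suc by simp_all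
  then show ?thesis
    unfolding \<MM>_def Let_def nodes leaves interval
    by (simp add: node_label_simps pos image_iff conj_assoc cong: ball_cong_simp conj_cong)
qed

text \<open>Peeling off the last level of nodes: the labels at the leaves of the shorter tree have to be
  derived in one step.\<close>

lemma \<MM>_Suc: "\<MM> mult meet vd (Suc n) z H \<longleftrightarrow> \<MM> mult meet vd n z (derive_step mult meet vd H)"
proof
  let ?node = "\<lambda>z x y t u v w. boxle mult meet vd (star_mult mult (Some (meet (meet u v) w)) x) y
    (star_mult mult z t)"
  let ?label = "node_label mult meet z"
  let ?last = "{2 ^ n..<2 ^ Suc n :: nat}"
  have pos: "0 < k" if "k \<in> ?last" for k
    using that by (auto intro: less_le_trans[of 0 "2 ^ n"])
  have split: "{1..<2 ^ Suc n :: nat} = {1..<2 ^ n} \<union> ?last" by auto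
  have leaves: "{2 ^ Suc n..<2 ^ Suc (Suc n)} = {2 * 2 ^ n..<2 * 2 ^ Suc n :: nat}" by simp
  {
    assume "\<MM> mult meet vd (Suc n) z H"
    then obtain x y t u v w where
      nodes: "\<And>k. k \<in> {1..<2 ^ Suc n} \<Longrightarrow>
        ?node (?label x u v w k) (x k) (y k) (t k) (u k) (v k) (w k)"
      and leaf: "\<And>k. k \<in> ?last \<Longrightarrow>
        ?label x u v w (2 * k) \<in> Some ` H \<and> ?label x u v w (Suc (2 * k)) \<in> Some ` H"
      unfolding \<MM>_iff_node_label leaves all_double_interval by blast
    have "?label x u v w k \<in> Some ` derive_step mult meet vd H" if "k \<in> ?last" for k
    proof -
      \<comment> \<open>A label is never \<open>e\<close>: it is an element of G or has one as a
        left factor.\<close>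
      obtain p where p: "?label x u v w k = Some p"
        by (cases "x (k div 2)") (force simp: node_label_def)+
      have "?node (Some p) (x k) (y k) (t k) (u k) (v k) (w k)"
        using nodes[of k] that pos[OF that] p by simp
      moreover have "meet (u k) (v k) \<in> H"
        "star_mult mult (Some (meet (v k) (w k))) (x k) \<in> Some ` H"
        using leaf[OF that] pos[OF that] by (auto simp: node_label_simps)
      ultimately have "p \<in> derive_step mult meet vd H" unfolding derive_step_def by blast
      with p show ?thesis by simp
    qed
    moreover from nodes have
      "\<forall>k\<in>{1..<2 ^ n}. ?node (?label x u v w k) (x k) (y k) (t k) (u k) (v k) (w k)"
      by (simp add: split)
    ultimately show "\<MM> mult meet vd n z (derive_step mult meet vd H)"
      unfolding \<MM>_iff_node_label
      by (intro exI[of _ x] exI[of _ y] exI[of _ t] exI[of _ u] exI[of _ v] exI[of _ w] conjI ballI)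
        simp_all
  next
    assume "\<MM> mult meet vd n z (derive_step mult meet vd H)"
    then obtain x y t u v w where
      nodes: "\<And>k. k \<in> {1..<2 ^ n} \<Longrightarrow>
        ?node (?label x u v w k) (x k) (y k) (t k) (u k) (v k) (w k)"
      and leaf: "\<And>k. k \<in> ?last \<Longrightarrow> ?label x u v w k \<in> Some ` derive_step mult meet vd H"
      unfolding \<MM>_iff_node_label by blast
    have "\<exists>x' y' t' u' v' w'. k \<in> ?last \<longrightarrow> ?node (?label x u v w k) x' y' t' u' v' w' \<and>
        meet u' v' \<in> H \<and> star_mult mult (Some (meet v' w')) x' \<in> Some ` H" for k
      using leaf[of k] unfolding derive_step_def by fastforce
    then obtain x' y' t' u' v' w' where last: "\<And>k. k \<in> ?last \<Longrightarrow>
        ?node (?label x u v w k) (x' k) (y' k) (t' k) (u' k) (v' k) (w' k) \<and>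
        meet (u' k) (v' k) \<in> H \<and> star_mult mult (Some (meet (v' k) (w' k))) (x' k) \<in> Some ` H"
      by metis
    \<comment> \<open>The new level is grafted onto the old tree. A label with index less than
      \<open>2 ^ Suc n\<close> depends only on data with index less than \<open>2 ^ n\<close>, so it
      does not change.\<close>
    define X where "X k = (if k < 2 ^ n then x k else x' k)" for k
    define Y where "Y k = (if k < 2 ^ n then y k else y' k)" for k
    define T where "T k = (if k < 2 ^ n then t k else t' k)" for k
    define U where "U k = (if k < 2 ^ n then u k else u' k)" for k
    define V where "V k = (if k < 2 ^ n then v k else v' k)" for k
    define W where "W k = (if k < 2 ^ n then w k else w' k)" for k
    note defs = X_def Y_def T_def U_def V_def W_def
    have label: "?label X U V W k = ?label x u v w k" if "k < 2 ^ Suc n" for k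
      using that by (auto simp: node_label_def defs)
    have "?node (?label X U V W k) (X k) (Y k) (T k) (U k) (V k) (W k)" if "k \<in> {1..<2 ^ Suc n}" for k
    proof (cases "k < 2 ^ n")
      case True
      then show ?thesis using nodes[of k] that label[of k] by (simp add: defs)
    next
      case False
      then show ?thesis using last[of k] that label[of k] by (simp add: defs)
    qed
    moreover have "?label X U V W (2 * k) \<in> Some ` H \<and> ?label X U V W (Suc (2 * k)) \<in> Some ` H"
      if "k \<in> ?last" for k
      using last[OF that] pos[OF that] that by (simp add: node_label_simps defs)
    ultimately show "\<MM> mult meet vd (Suc n) z H"
      unfolding \<MM>_iff_node_label leaves all_double_interval
      by (intro exI[of _ X] exI[of _ Y] exI[of _ T] exI[of _ U] exI[of _ V] exI[of _ W] conjI ballI)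
        simp_all
  }
qed

text \<open>Peeling off a level replaces \<open>H\<close> by its derived set, hence the
  generalisation over \<open>H\<close> and the unfolding of the iterate from the inside.\<close>

lemma \<MM>_iff_funpow: "\<MM> mult meet vd n z H \<longleftrightarrow> z \<in> (derive_step mult meet vd ^^ n) H"
  by (induction n arbitrary: H) (simp_all add: \<MM>_Suc funpow_Suc_right del: funpow.simps(2),
      simp add: \<MM>_def)


section \<open>Necessity\<close>

locale cap_representation =
  fixes mult :: "'g \<Rightarrow> 'g \<Rightarrow> 'g" and meet :: "'g \<Rightarrow> 'g \<Rightarrow> 'g" and vd :: "'g \<Rightarrow> 'g \<Rightarrow> bool"
    and P :: "'g \<Rightarrow> 'b rel"
  assumes inj: "inj P"
    and single_valued: "single_valued (P x)"
    and P_mult: "P (mult x y) = P x O P y"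
    and P_meet: "P (meet x y) = P x \<inter> P y"
    and vd_iff: "vd x y \<longleftrightarrow> Range (P x) \<subseteq> Domain (P y)"
begin

text \<open>The identity on the whole type stands for \<open>e\<close>, so that \<open>star\<close>
  turns products with \<open>e\<close> into compositions too.\<close>

definition star :: "'g option \<Rightarrow> 'b rel"
  where "star x = (case x of None \<Rightarrow> Id | Some g \<Rightarrow> P g)"

lemma star_Some [simp]: "star (Some g) = P g"
  by (simp add: star_def)

lemma star_star_mult: "star (star_mult mult x y) = star x O star y"
  by (cases x; cases y) (simp_all add: star_def P_mult)

lemma natural_le_iff: "natural_le meet x y \<longleftrightarrow> P x \<subseteq> P y"
  using inj by (metis P_meet inf.absorb_iff1 injD natural_le_def)

lemma boxle_starD:
  assumes "boxle mult meet vd x y z"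
  shows "Range (star x) \<subseteq> Domain (star y)" "star x O star y \<subseteq> star z"
proof -
  show "Range (star x) \<subseteq> Domain (star y)"
    using assms by (auto simp: boxle_def star_vd_def star_def vd_iff split: option.splits)
  have "rel_option (natural_le meet) (star_mult mult x y) z"
    using assms by (simp add: boxle_def)
  then have "star (star_mult mult x y) \<subseteq> star z"
    by cases (auto simp: natural_le_iff)
  then show "star x O star y \<subseteq> star z" by (simp add: star_star_mult)
qed

text \<open>At \<open>a\<close>, both \<open>u\<close> and \<open>w\<close> agree with
  \<open>v\<close>. Then \<open>x\<close> applies to the common value, \<open>y\<close> is defined
  at the result by the relation, and the inequality makes \<open>z\<close> followed by
  \<open>t\<close> defined at \<open>a\<close>.\<close>

lemma derive_step_defined_at:
  "derive_step mult meet vd {z. a \<in> Domain (P z)} \<subseteq> {z. a \<in> Domain (P z)}"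
proof
  fix z assume "z \<in> derive_step mult meet vd {z. a \<in> Domain (P z)}"
  then obtain x y t u v w where
    box: "boxle mult meet vd (star_mult mult (Some (meet (meet u v) w)) x) y
      (star_mult mult (Some z) t)"
    and uv: "a \<in> Domain (P (meet u v))"
    and vwx: "star_mult mult (Some (meet v w)) x \<in> Some ` {z. a \<in> Domain (P z)}"
    unfolding derive_step_def by blast
  have "a \<in> Domain (star (star_mult mult (Some (meet v w)) x))" using vwx by force
  then obtain b c where b: "(a, b) \<in> P v \<inter> P w" and c: "(b, c) \<in> star x"
    by (auto simp: star_star_mult P_meet)
  from uv obtain b' where "(a, b') \<in> P u \<inter> P v" by (auto simp: P_meet)
  with b have "(a, b) \<in> P u \<inter> P v \<inter> P w"
    using single_valued[of v] by (auto dest: single_valuedD)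
  with c have ac: "(a, c) \<in> star (star_mult mult (Some (meet (meet u v) w)) x)"
    by (auto simp: star_star_mult P_meet)
  then obtain d where "(c, d) \<in> star y" using boxle_starD(1)[OF box] by blast
  with ac have "(a, d) \<in> star (star_mult mult (Some z) t)" using boxle_starD(2)[OF box] by blast
  then show "z \<in> {z. a \<in> Domain (P z)}" by (auto simp: star_star_mult)
qed

text \<open>The elements defined at a point of the domain of \<open>x\<close> include
  \<open>x\<close> and are stable under derivation, so by monotonicity every iterate stays among
  them.\<close>

lemma \<MM>_Domain_subset:
  assumes "\<MM> mult meet vd n z {x}"
  shows "Domain (P x) \<subseteq> Domain (P z)"
proof
  fix a assume "a \<in> Domain (P x)"
  let ?f = "derive_step mult meet vd" and ?D = "{z. a \<in> Domain (P z)}"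
  have "(?f ^^ m) {x} \<subseteq> ?D" for m
  proof (induction m)
    case (Suc m)
    then have "?f ((?f ^^ m) {x}) \<subseteq> ?f ?D" by (rule monoD[OF derive_step_mono])
    with derive_step_defined_at show ?case by auto
  qed (use \<open>a \<in> Domain (P x)\<close> in simp)
  with assms show "a \<in> Domain (P z)" by (auto simp: \<MM>_iff_funpow)
qed

lemma left_ideal: "left_ideal_rel mult vd"
  by (auto simp: left_ideal_rel_def vd_iff P_mult)

text \<open>Composition distributes over this intersection because \<open>P x\<close> leaves a
  single middle point.\<close>

lemma mult_meet_right: "mult x (meet y z) = meet (mult x y) (mult x z)"
proof (rule injD[OF inj])
  show "P (mult x (meet y z)) = P (meet (mult x y) (mult x z))"
    using single_valued[of x] by (auto simp: P_mult P_meet dest: single_valuedD)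
qed

lemma mult_meet_left_le: "natural_le meet (mult (meet x y) z) (mult y z)"
  by (auto simp: natural_le_iff P_mult P_meet)

lemma \<MM>_meet_imp_le:
  assumes "\<MM> mult meet vd n (meet x y) {x}"
  shows "natural_le meet x y"
  using \<MM>_Domain_subset[OF assms] single_valued[of x]
  by (fastforce simp: natural_le_iff P_meet dest: single_valuedD)

lemma \<MM>_mult_imp_vd:
  assumes "\<MM> mult meet vd n (mult x y) {x}"
  shows "vd x y"
  using \<MM>_Domain_subset[OF assms] single_valued[of x]
  by (fastforce simp: vd_iff P_mult dest: single_valuedD)

end

lemma cap_representationE:
  fixes A :: "'b set" and mult :: "'g \<Rightarrow> 'g \<Rightarrow> 'g"
  assumes "cap_semigroup A \<Phi>" "isomorphic_to mult meet vd \<Phi>"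
  obtains P :: "'g \<Rightarrow> 'b rel" where "cap_representation mult meet vd P"
proof -
  from assms(2) obtain P :: "'g \<Rightarrow> 'b rel" where P: "bij_betw P UNIV \<Phi>"
    "\<And>x y. P (mult x y) = P y \<circ>\<circ> P x" "\<And>x y. P (meet x y) = P x \<inter> P y"
    "\<And>x y. vd x y \<longleftrightarrow> (P x, P y) \<in> delta \<Phi>"
    unfolding isomorphic_to_def by blast
  then have mem: "P x \<in> \<Phi>" for x by (auto simp: bij_betw_def)
  then have "single_valued (P x)" for x
    using assms(1) by (auto simp: cap_semigroup_def transformations_def)
  with P mem have "cap_representation mult meet vd P"
    by unfold_locales (auto simp: bij_betw_def after_def delta_def)
  then show thesis by (rule that)
qed


section \<open>Sufficiency\<close>

lemma (in semilattice) subset_derive_step: "H \<subseteq> derive_step mult (\<^bold>*) vd H"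
proof
  fix z assume "z \<in> H"
  then show "z \<in> derive_step mult (\<^bold>*) vd H"
    unfolding derive_step_def
    \<comment> \<open>The degenerate node: \<open>u\<close>, \<open>v\<close>, \<open>w\<close> all
      equal \<open>z\<close>, and \<open>x\<close>, \<open>y\<close>, \<open>t\<close> all equal
      \<open>e\<close>.\<close>
    by (intro CollectI exI[of _ None] exI[of _ z])
      (auto simp: boxle_def star_vd_def natural_le_def)
qed

text \<open>The union of all iterates of \<open>derive_step\<close> on \<open>{a}\<close>;
  membership in it is the premise of A_n or B_n for some n.\<close>

definition derivable ::
    "('g \<Rightarrow> 'g \<Rightarrow> 'g) \<Rightarrow> ('g \<Rightarrow> 'g \<Rightarrow> 'g) \<Rightarrow> ('g \<Rightarrow> 'g \<Rightarrow> bool) \<Rightarrow> 'g \<Rightarrow> 'g set"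
  where "derivable mult meet vd a = {z. \<exists>n. \<MM> mult meet vd n z {a}}"

lemma derivable_self: "a \<in> derivable mult meet vd a"
  by (auto simp: derivable_def intro!: exI[of _ 0] simp: \<MM>_def)

text \<open>The two premises of a derivation may come from different iterates. As the iterates
  increase, both lie in the later one, and the next iterate contains \<open>z\<close>.\<close>

lemma (in semilattice) derive_step_derivable:
  "derive_step mult (\<^bold>*) vd (derivable mult (\<^bold>*) vd a) \<subseteq> derivable mult (\<^bold>*) vd a"
proof
  let ?f = "derive_step mult (\<^bold>*) vd"
  fix z assume "z \<in> ?f (derivable mult (\<^bold>*) vd a)"
  then obtain x y t u v w p where
    box: "boxle mult (\<^bold>*) vd (star_mult mult (Some (u \<^bold>* v \<^bold>* w)) x) y
      (star_mult mult (Some z) t)"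
    and uv: "u \<^bold>* v \<in> derivable mult (\<^bold>*) vd a"
    and p: "star_mult mult (Some (v \<^bold>* w)) x = Some p" "p \<in> derivable mult (\<^bold>*) vd a"
    unfolding derive_step_def by blast
  from uv p(2) obtain m n where mn: "u \<^bold>* v \<in> (?f ^^ m) {a}" "p \<in> (?f ^^ n) {a}"
    by (auto simp: derivable_def \<MM>_iff_funpow)
  have "(?f ^^ i) {a} \<subseteq> (?f ^^ j) {a}" if "i \<le> j" for i j
    using that by (rule lift_Suc_mono_le[rotated]) (simp add: subset_derive_step)
  with mn have "u \<^bold>* v \<in> (?f ^^ max m n) {a}" "p \<in> (?f ^^ max m n) {a}"
    by (meson max.cobounded1 max.cobounded2 subsetD)+
  with box p(1) have "z \<in> ?f ((?f ^^ max m n) {a})"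
    unfolding derive_step_def by blast
  then have "\<MM> mult (\<^bold>*) vd (Suc (max m n)) z {a}"
    by (simp add: \<MM>_iff_funpow)
  then show "z \<in> derivable mult (\<^bold>*) vd a"
    unfolding derivable_def by blast
qed

text \<open>From these axioms come the partial maps that respect product, meet and relation; A_n and
  B_n enter later, to make them faithful.\<close>

locale meet_semigroup = semigroup mult + meet: semilattice meet
  for mult :: "'g \<Rightarrow> 'g \<Rightarrow> 'g"  (infixl \<open>\<cdot>\<close> 75)
    and meet :: "'g \<Rightarrow> 'g \<Rightarrow> 'g"  (infixl \<open>\<and>\<and>\<close> 70) +
  fixes vd :: "'g \<Rightarrow> 'g \<Rightarrow> bool"  (infix \<open>\<turnstile>\<close> 50)
  assumes vd_left_ideal: "left_ideal_rel mult vd"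
    and mult_meet_right: "x \<cdot> (y \<and>\<and> z) = x \<cdot> y \<and>\<and> x \<cdot> z"
    and mult_meet_left_le: "natural_le meet ((x \<and>\<and> y) \<cdot> z) (y \<cdot> z)"
begin

abbreviation star_times (infixl \<open>\<odot>\<close> 75)
  where "x \<odot> y \<equiv> star_mult mult x y"

lemma star_times_assoc: "x \<odot> (y \<odot> z) = x \<odot> y \<odot> z"
  by (cases x; cases y; cases z) (simp_all add: assoc)

lemma le_meet:
  assumes "natural_le meet x y" "natural_le meet x z"
  shows "natural_le meet x (y \<and>\<and> z)"
  using assms by (metis natural_le_def meet.assoc)

lemma mult_meet_left_le': "natural_le meet ((x \<and>\<and> y) \<cdot> z) (x \<cdot> z)"
  by (metis meet.commute mult_meet_left_le)

text \<open>\<open>H\<close> plays the part of the set of elements defined at a point, and \<open>sim H x y\<close> says that \<open>x\<close> and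
  \<open>y\<close> have the same value there.\<close>

definition closed :: "'g set \<Rightarrow> bool"
  where "closed H \<longleftrightarrow> derive_step mult meet vd H \<subseteq> H"

definition sim :: "'g set \<Rightarrow> 'g option \<Rightarrow> 'g option \<Rightarrow> bool"
  where "sim H = rel_option (\<lambda>x y. x \<and>\<and> y \<in> H)"

text \<open>A representative instead of a class keeps states in the type \<open>'g option\<close>.
  The choice is meaningful only where \<open>sim H x x\<close> holds; the class of \<open>e\<close>
  is \<open>e\<close> alone.\<close>

definition state :: "'g set \<Rightarrow> 'g option \<Rightarrow> 'g option"
  where "state H x = (SOME y. sim H x y)"

text \<open>Right multiplication by \<open>g\<close> on states. Admitting \<open>e\<close> for
  \<open>x\<close> gives an arrow from the state of \<open>e\<close> to that of \<open>g\<close>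
  whenever \<open>g\<close> is in \<open>H\<close>.\<close>

definition rep :: "'g set \<Rightarrow> 'g \<Rightarrow> 'g option rel"
  where "rep H g = {(state H x, state H (x \<odot> Some g)) | x. x \<odot> Some g \<in> Some ` H}"

text \<open>The closure properties below are instances of this rule, each bringing one part of the
  node data into play: the inequality, \<open>t\<close>, \<open>y\<close>, the three meets, and
  \<open>x\<close>.\<close>

lemma closedD:
  assumes "closed H"
    and "u \<and>\<and> v \<in> H" "Some (v \<and>\<and> w) \<odot> x \<in> Some ` H"
    and "boxle mult meet vd (Some (u \<and>\<and> v \<and>\<and> w) \<odot> x) y (Some z \<odot> t)"
  shows "z \<in> H"
  using assms unfolding closed_def derive_step_def by blast

section \<open>Closure properties of closed sets\<close>

context
  fixes H :: "'g set"
  assumes closed: "closed H"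
begin

lemma closed_upward:
  assumes "x \<in> H" "natural_le meet x y"
  shows "y \<in> H"
  by (rule closedD[OF closed, where u = x and v = x and w = x and x = None and y = None and t = None])
    (use assms in \<open>auto simp: boxle_def star_vd_def\<close>)

lemma closed_left_factor:
  assumes "x \<cdot> y \<in> H"
  shows "x \<in> H"
  by (rule closedD[OF closed, where u = "x \<cdot> y" and v = "x \<cdot> y" and w = "x \<cdot> y"
        and x = None and y = None and t = "Some y"])
    (use assms in \<open>auto simp: boxle_def star_vd_def natural_le_def\<close>)

lemma closed_vd:
  assumes "x \<in> H" "x \<turnstile> y"
  shows "x \<cdot> y \<in> H"
  by (rule closedD[OF closed, where u = x and v = x and w = x
        and x = None and y = "Some y" and t = None])
    (use assms in \<open>auto simp: boxle_def star_vd_def natural_le_def\<close>)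

lemma closed_meet_trans:
  assumes "u \<and>\<and> v \<in> H" "v \<and>\<and> w \<in> H"
  shows "u \<and>\<and> v \<and>\<and> w \<in> H"
  by (rule closedD[OF closed, where u = u and v = v and w = w
        and x = None and y = None and t = None])
    (use assms in \<open>auto simp: boxle_def star_vd_def natural_le_def\<close>)

text \<open>Taking \<open>w = v\<close> puts \<open>(u \<and>\<and> v) \<cdot> x\<close> into
  \<open>H\<close>, and this element lies below both products.\<close>

lemma closed_meet_mult:
  assumes "u \<and>\<and> v \<in> H" "v \<cdot> x \<in> H"
  shows "u \<cdot> x \<and>\<and> v \<cdot> x \<in> H"
proof (rule closed_upward)
  show "(u \<and>\<and> v) \<cdot> x \<in> H"
    by (rule closedD[OF closed, where u = u and v = v and w = v
          and x = "Some x" and y = None and t = None])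
      (use assms in \<open>auto simp: boxle_def star_vd_def natural_le_def meet.assoc\<close>)
  show "natural_le meet ((u \<and>\<and> v) \<cdot> x) (u \<cdot> x \<and>\<and> v \<cdot> x)"
    by (intro le_meet mult_meet_left_le mult_meet_left_le')
qed

lemma closed_meetD:
  assumes "x \<and>\<and> y \<in> H"
  shows "x \<in> H" "y \<in> H"
  using closed_upward[OF assms] by (simp_all add: natural_le_def meet.assoc meet.commute meet.left_commute)

section \<open>Equality of values as a partial equivalence relation\<close>

lemma sim_sym: "sim H x y \<Longrightarrow> sim H y x"
  by (cases x; cases y) (simp_all add: sim_def meet.commute)

text \<open>\<open>closed_meet_trans\<close> gives the triple meet, and upward closure removes the
  middle element.\<close>

lemma sim_trans:
  assumes "sim H x y" "sim H y z"
  shows "sim H x z"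
proof -
  have trans: "u \<and>\<and> w \<in> H" if "u \<and>\<and> v \<in> H" "v \<and>\<and> w \<in> H" for u v w
    using closed_upward[OF closed_meet_trans[OF that], of "u \<and>\<and> w"]
    by (simp add: natural_le_def meet.assoc meet.commute meet.left_commute)
  from assms show ?thesis
    by (cases x; cases y; cases z) (auto simp: sim_def intro: trans)
qed

lemma sim_refl_Some: "x \<in> Some ` H \<Longrightarrow> sim H x x"
  by (auto simp: sim_def)

lemma sim_refl: "x \<odot> Some g \<in> Some ` H \<Longrightarrow> sim H x x"
  by (cases x) (auto simp: sim_def dest: closed_left_factor)

lemma sim_times:
  assumes "sim H x y" "y \<odot> Some g \<in> Some ` H"
  shows "sim H (x \<odot> Some g) (y \<odot> Some g)"
  using assms by (cases x; cases y) (auto simp: sim_def closed_meet_mult)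

lemma sim_Some_memD: "sim H x y \<Longrightarrow> y \<noteq> None \<Longrightarrow> x \<in> Some ` H"
  by (cases x; cases y) (auto simp: sim_def dest: closed_meetD)

text \<open>Reflexivity makes the choice land in the class, and equal classes yield the same
  choice.\<close>

lemma state_eq_iff:
  assumes "sim H x x" "sim H y y"
  shows "state H x = state H y \<longleftrightarrow> sim H x y"
proof
  assume "state H x = state H y"
  moreover have "sim H x (state H x)" "sim H y (state H y)"
    unfolding state_def using assms by (blast intro: someI)+
  ultimately show "sim H x y" using sim_sym sim_trans by metis
next
  assume "sim H x y"
  then have "sim H x = sim H y" using sim_sym sim_trans by blast
  then show "state H x = state H y" by (simp add: state_def)
qed

lemma star_times_left_mem:
  assumes "x \<odot> Some g \<odot> Some h \<in> Some ` H"
  shows "x \<odot> Some g \<in> Some ` H"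
  using assms by (cases x) (auto dest: closed_left_factor)

lemma repE:
  assumes "(p, q) \<in> rep H g"
  obtains x where "p = state H x" "q = state H (x \<odot> Some g)" "x \<odot> Some g \<in> Some ` H"
  using assms by (auto simp: rep_def)

lemma repI: "x \<odot> Some g \<in> Some ` H \<Longrightarrow> (state H x, state H (x \<odot> Some g)) \<in> rep H g"
  by (auto simp: rep_def)

lemma sim_times_mem:
  assumes "sim H x y" "y \<odot> Some g \<in> Some ` H"
  shows "x \<odot> Some g \<in> Some ` H"
  using sim_times[OF assms] assms(2) by (auto intro: sim_Some_memD)

section \<open>The partial maps attached to a closed set\<close>

lemma rep_single_valued: "single_valued (rep H g)"
proof (rule single_valuedI)
  fix p q r assume "(p, q) \<in> rep H g" "(p, r) \<in> rep H g"
  then obtain x y where x: "p = state H x" "q = state H (x \<odot> Some g)" "x \<odot> Some g \<in> Some ` H"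
    and y: "p = state H y" "r = state H (y \<odot> Some g)" "y \<odot> Some g \<in> Some ` H"
    by (metis repE)
  then have "sim H x y" by (metis state_eq_iff sim_refl)
  then have "sim H (x \<odot> Some g) (y \<odot> Some g)" using y by (simp add: sim_times)
  then show "q = r" using x y by (simp add: state_eq_iff sim_refl_Some)
qed

lemma rep_mult: "rep H (g \<cdot> h) = rep H g O rep H h"
proof -
  have times: "x \<odot> Some (g \<cdot> h) = x \<odot> Some g \<odot> Some h" for x
    using star_times_assoc[of x "Some g" "Some h"] by simp
  show ?thesis
  proof (intro set_eqI iffI; clarify)
    fix p q assume "(p, q) \<in> rep H (g \<cdot> h)"
    then obtain x where x: "p = state H x" "q = state H (x \<odot> Some g \<odot> Some h)"
      "x \<odot> Some g \<odot> Some h \<in> Some ` H"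
      unfolding times[symmetric] by (rule repE)
    then show "(p, q) \<in> rep H g O rep H h"
      using repI[OF star_times_left_mem[OF x(3)]] repI[OF x(3)] by (simp only:) (rule relcompI)
  next
    fix p q r assume "(p, q) \<in> rep H g" "(q, r) \<in> rep H h"
    then obtain x y where x: "p = state H x" "q = state H (x \<odot> Some g)" "x \<odot> Some g \<in> Some ` H"
      and y: "q = state H y" "r = state H (y \<odot> Some h)" "y \<odot> Some h \<in> Some ` H"
      by (metis repE)
    \<comment> \<open>The middle state has two representatives; being related, they let
      \<open>h\<close> apply to the first as well.\<close>
    then have sim: "sim H (x \<odot> Some g) y" by (metis state_eq_iff sim_refl sim_refl_Some)
    then have mem: "x \<odot> Some (g \<cdot> h) \<in> Some ` H" using y by (simp add: times sim_times_mem)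
    moreover have "r = state H (x \<odot> Some (g \<cdot> h))"
      using sim_times[OF sim y(3)] y mem by (simp add: times state_eq_iff sim_refl_Some sim_sym)
    ultimately show "(p, r) \<in> rep H (g \<cdot> h)" using x repI by simp
  qed
qed

lemma star_times_meet_mem_iff:
  "x \<odot> Some (g \<and>\<and> h) \<in> Some ` H \<longleftrightarrow> sim H (x \<odot> Some g) (x \<odot> Some h)"
  by (cases x) (auto simp: sim_def mult_meet_right)

lemma sim_star_times_meet:
  assumes "x \<odot> Some (g \<and>\<and> h) \<in> Some ` H"
  shows "sim H (x \<odot> Some (g \<and>\<and> h)) (x \<odot> Some g)" "sim H (x \<odot> Some (g \<and>\<and> h)) (x \<odot> Some h)"
proof -
  have "p \<and>\<and> q \<and>\<and> p = p \<and>\<and> q" "p \<and>\<and> q \<and>\<and> q = p \<and>\<and> q" for p q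
    by (simp_all add: meet.assoc meet.commute meet.left_commute)
  with assms show "sim H (x \<odot> Some (g \<and>\<and> h)) (x \<odot> Some g)"
    "sim H (x \<odot> Some (g \<and>\<and> h)) (x \<odot> Some h)"
    by (cases x; auto simp: sim_def mult_meet_right)+
qed

lemma rep_meet: "rep H (g \<and>\<and> h) = rep H g \<inter> rep H h"
proof (intro set_eqI iffI; clarify)
  fix p q assume "(p, q) \<in> rep H (g \<and>\<and> h)"
  then obtain x where x: "p = state H x" "q = state H (x \<odot> Some (g \<and>\<and> h))"
    "x \<odot> Some (g \<and>\<and> h) \<in> Some ` H"
    by (rule repE)
  have "(p, q) \<in> rep H k" if sim: "sim H (x \<odot> Some (g \<and>\<and> h)) (x \<odot> Some k)" for k
  proof -
    have "x \<odot> Some k \<in> Some ` H" using sim_Some_memD[OF sim_sym[OF sim]] x(3) by auto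
    with sim x show ?thesis using repI[of x k] by (metis state_eq_iff sim_refl_Some)
  qed
  with sim_star_times_meet[OF x(3)] show "(p, q) \<in> rep H g \<inter> rep H h" by blast
next
  fix p q assume "(p, q) \<in> rep H g" "(p, q) \<in> rep H h"
  then obtain x y where x: "p = state H x" "q = state H (x \<odot> Some g)" "x \<odot> Some g \<in> Some ` H"
    and y: "p = state H y" "q = state H (y \<odot> Some h)" "y \<odot> Some h \<in> Some ` H"
    by (metis repE)
  then have "sim H x y" "sim H (x \<odot> Some g) (y \<odot> Some h)"
    by (metis state_eq_iff sim_refl sim_refl_Some)+
  \<comment> \<open>The two arrows may come from different representatives; passing from
    \<open>y\<close> to \<open>x\<close> in the second product lets one representative serve both
    maps.\<close>
  then have "sim H (x \<odot> Some g) (x \<odot> Some h)" using y(3) sim_times sim_sym sim_trans by blast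
  then have mem: "x \<odot> Some (g \<and>\<and> h) \<in> Some ` H" by (simp add: star_times_meet_mem_iff)
  then have "q = state H (x \<odot> Some (g \<and>\<and> h))"
    using sim_star_times_meet(1)[OF mem] x by (simp add: state_eq_iff sim_refl_Some sim_sym)
  with mem x(1) show "(p, q) \<in> rep H (g \<and>\<and> h)" using repI by simp
qed

lemma rep_vd:
  assumes "g \<turnstile> h"
  shows "Range (rep H g) \<subseteq> Domain (rep H h)"
proof
  fix q assume "q \<in> Range (rep H g)"
  then obtain x where x: "q = state H (x \<odot> Some g)" "x \<odot> Some g \<in> Some ` H"
    by (auto simp: rep_def)
  then obtain k where k: "x \<odot> Some g = Some k" "k \<in> H" by blast
  \<comment> \<open>For \<open>x = e\<close> this is the assumption; otherwise \<open>k\<close> is a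
    left multiple of \<open>g\<close> and the left ideal property applies.\<close>
  have "k \<turnstile> h"
    using assms vd_left_ideal k(1) by (cases x) (auto simp: left_ideal_rel_def)
  then have "k \<cdot> h \<in> H" using k(2) by (simp add: closed_vd)
  then have "(state H (Some k), state H (Some k \<odot> Some h)) \<in> rep H h" by (intro repI) simp
  then show "q \<in> Domain (rep H h)" using x k by auto
qed

lemma mem_if_rep_subset:
  assumes "g \<in> H" "rep H g \<subseteq> rep H h"
  shows "g \<and>\<and> h \<in> H"
proof -
  have "(state H None, state H (None \<odot> Some g)) \<in> rep H g \<inter> rep H h"
    using repI[of None g] assms by auto
  then obtain x where "state H None = state H x" "x \<odot> Some (g \<and>\<and> h) \<in> Some ` H"
    by (metis rep_meet repE)
  \<comment> \<open>Only \<open>e\<close> is related to \<open>e\<close>, so \<open>x\<close> is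
    \<open>e\<close> and the product is the meet itself.\<close>
  moreover from this have "sim H None x" by (metis state_eq_iff sim_refl sim_def option.rel_intros(1))
  ultimately show ?thesis by (auto simp: sim_def)
qed

lemma mem_if_Range_subset_Domain:
  assumes "g \<in> H" "Range (rep H g) \<subseteq> Domain (rep H h)"
  shows "g \<cdot> h \<in> H"
proof -
  \<comment> \<open>The state of \<open>g\<close> lies in the range because it is reached from
    \<open>e\<close>.\<close>
  have "state H (Some g) \<in> Domain (rep H h)"
    using repI[of None g] assms by auto
  then obtain x where x: "state H (Some g) = state H x" "x \<odot> Some h \<in> Some ` H"
    by (auto simp: rep_def)
  then have "sim H (Some g) x"
    using assms(1) by (metis image_eqI state_eq_iff sim_refl sim_refl_Some)
  then have "Some g \<odot> Some h \<in> Some ` H" using x(2) by (rule sim_times_mem)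
  then show ?thesis by auto
qed

end

section \<open>The disjoint union over all elements\<close>

lemma closed_derivable: "closed (derivable mult meet vd a)"
  by (simp add: closed_def meet.derive_step_derivable)

text \<open>The first component tags the copy, so that the systems for different \<open>a\<close>
  stay disjoint.\<close>

definition sum_rep :: "'g \<Rightarrow> ('g \<times> 'g option) rel"
  where "sum_rep g = {((a, p), (a, q)) | a p q. (p, q) \<in> rep (derivable mult meet vd a) g}"

lemma sum_rep_iff:
  "((a, p), (b, q)) \<in> sum_rep g \<longleftrightarrow> a = b \<and> (p, q) \<in> rep (derivable mult meet vd a) g"
  by (auto simp: sum_rep_def)

lemma sum_rep_single_valued: "single_valued (sum_rep g)"
  by (rule single_valuedI)
    (auto simp: sum_rep_iff dest: single_valuedD[OF rep_single_valued[OF closed_derivable]])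

lemma sum_rep_mult: "sum_rep (g \<cdot> h) = sum_rep g O sum_rep h"
  by (auto simp: sum_rep_def rep_mult[OF closed_derivable])

lemma sum_rep_meet: "sum_rep (g \<and>\<and> h) = sum_rep g \<inter> sum_rep h"
  by (auto simp: sum_rep_def rep_meet[OF closed_derivable])

lemma sum_rep_subset_iff:
  "sum_rep g \<subseteq> sum_rep h \<longleftrightarrow>
    (\<forall>a. rep (derivable mult meet vd a) g \<subseteq> rep (derivable mult meet vd a) h)"
  by (fastforce simp: sum_rep_def)

lemma sum_rep_Range_subset_Domain_iff:
  "Range (sum_rep g) \<subseteq> Domain (sum_rep h) \<longleftrightarrow>
    (\<forall>a. Range (rep (derivable mult meet vd a) g) \<subseteq> Domain (rep (derivable mult meet vd a) h))"
proof -
  have *: "(a, q) \<in> Range (sum_rep g) \<longleftrightarrow> q \<in> Range (rep (derivable mult meet vd a) g)"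
    "(a, q) \<in> Domain (sum_rep h) \<longleftrightarrow> q \<in> Domain (rep (derivable mult meet vd a) h)" for a q
    by (auto simp: sum_rep_def)
  show ?thesis by (simp only: subset_iff split_paired_All *)
qed

lemma sum_rep_isomorphic:
  assumes A: "\<And>n x y. \<MM> mult meet vd n (x \<and>\<and> y) {x} \<Longrightarrow> natural_le meet x y"
    and B: "\<And>n x y. \<MM> mult meet vd n (x \<cdot> y) {x} \<Longrightarrow> x \<turnstile> y"
  shows "cap_semigroup UNIV (range sum_rep)" "isomorphic_to mult meet vd (range sum_rep)"
proof -
  show "cap_semigroup UNIV (range sum_rep)"
    by (auto simp: cap_semigroup_def transformations_def sum_rep_single_valued after_def
        simp flip: sum_rep_mult sum_rep_meet)
  \<comment> \<open>The copy tagged \<open>g\<close> decides: its closed set contains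
    \<open>g\<close>, hence also the meet, which is the premise of A_n for some n.\<close>
  have le: "natural_le meet g h" if "sum_rep g \<subseteq> sum_rep h" for g h
    using that mem_if_rep_subset[OF closed_derivable derivable_self, of g h] A
    by (auto simp: sum_rep_subset_iff derivable_def)
  have "inj sum_rep"
  proof (rule injI)
    fix g h assume "sum_rep g = sum_rep h"
    then have "natural_le meet g h" "natural_le meet h g" by (simp_all add: le)
    then show "g = h" by (metis natural_le_def meet.commute)
  qed
  moreover have "g \<turnstile> h \<longleftrightarrow> Range (sum_rep g) \<subseteq> Domain (sum_rep h)" for g h
  proof
    assume "g \<turnstile> h"
    then show "Range (sum_rep g) \<subseteq> Domain (sum_rep h)"
      using rep_vd[OF closed_derivable] by (simp add: sum_rep_Range_subset_Domain_iff)
  next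
    assume "Range (sum_rep g) \<subseteq> Domain (sum_rep h)"
    then show "g \<turnstile> h"
      using mem_if_Range_subset_Domain[OF closed_derivable derivable_self, of g h] B
      by (auto simp: sum_rep_Range_subset_Domain_iff derivable_def)
  qed
  ultimately show "isomorphic_to mult meet vd (range sum_rep)"
    unfolding isomorphic_to_def
    by (intro exI[of _ sum_rep])
      (auto simp: bij_betw_def after_def delta_def sum_rep_mult sum_rep_meet)
qed

end

text \<open>Representability is stated over \<open>'g \<times> 'g option\<close>, the base type of
  the construction; the second conjunct carries a representation over any type \<open>'b\<close> to
  it, so that fixing the type costs no generality.\<close>

theorem theorem8:
  fixes mult :: "'g \<Rightarrow> 'g \<Rightarrow> 'g"  (infixl \<open>\<cdot>\<close> 75)
    and meet :: "'g \<Rightarrow> 'g \<Rightarrow> 'g"  (infixl \<open>\<and>\<and>\<close> 70)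
    and vd :: "'g \<Rightarrow> 'g \<Rightarrow> bool"  (infix \<open>\<turnstile>\<close> 50)
  assumes "semigroup mult" and "semilattice meet"
  shows "((\<exists>(A :: ('g \<times> 'g option) set) \<Phi>. cap_semigroup A \<Phi> \<and> isomorphic_to mult meet vd \<Phi>)
          \<longleftrightarrow>
          left_ideal_rel mult vd \<and>
          (\<forall>x y z. x \<cdot> (y \<and>\<and> z) = x \<cdot> y \<and>\<and> x \<cdot> z) \<and>
          (\<forall>x y z. natural_le meet ((x \<and>\<and> y) \<cdot> z) (y \<cdot> z)) \<and>
          (\<forall>n x y.
             (\<MM> mult meet vd n (x \<and>\<and> y) {x} \<longrightarrow> natural_le meet x y) \<and>
             (\<MM> mult meet vd n (x \<cdot> y) {x} \<longrightarrow> x \<turnstile> y)))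
         \<and>
         ((\<exists>(A :: 'b set) \<Phi>. cap_semigroup A \<Phi> \<and> isomorphic_to mult meet vd \<Phi>)
          \<longrightarrow>
          (\<exists>(A :: ('g \<times> 'g option) set) \<Phi>. cap_semigroup A \<Phi> \<and> isomorphic_to mult meet vd \<Phi>))"
    (is "(?rep \<longleftrightarrow> ?cond) \<and> (?rep' \<longrightarrow> ?rep)")
proof -
  \<comment> \<open>Generic in the base type \<open>'c\<close>, so that it applies to both base
    types of the statement.\<close>
  have necessity: ?cond
    if rep: "cap_semigroup A \<Phi>" "isomorphic_to mult meet vd \<Phi>" for A :: "'c set" and \<Phi>
  proof -
    obtain P :: "'g \<Rightarrow> 'c rel" where "cap_representation mult meet vd P" using rep by (rule cap_representationE)
    then interpret cap_representation mult meet vd P .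
    show ?cond
      using left_ideal mult_meet_right mult_meet_left_le \<MM>_meet_imp_le \<MM>_mult_imp_vd by blast
  qed
  have sufficiency: ?rep if cond: ?cond
  proof -
    interpret semigroup mult by fact
    interpret meet: semilattice meet by fact
    interpret meet_semigroup mult meet vd
      using cond by unfold_locales blast+
    show ?rep using sum_rep_isomorphic cond by blast
  qed
  show ?thesis
  proof (rule conjI; (rule iffI)?; (rule impI)?)
    assume ?rep
    then show ?cond by (elim exE conjE) (rule necessity)
  next
    assume ?cond
    then show ?rep by (rule sufficiency)
  next
    assume ?rep'
    then have ?cond by (elim exE conjE) (rule necessity)
    then show ?rep by (rule sufficiency)
  qed
qed

end
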